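(* If $x$ is a number then $\ast\!:\!x+\ast\!:\!\overline{x}\equiv 0\pmod{\mathcal D}$.
   Context: Games are finite two-player (Left and Right) partizan game forms $G=\{\mathcal G^L\mid \mathcal G^R\}$, with disjunctive sum $G+H$ (a move is a move in exactly one summand); $0=\{\cdot\mid\cdot\}$ and $\ast=\{0\mid0\}$. Under misère play a player unable to move on their turn wins. $o^-(G)\in\{\mathcal L,\mathcal R,\mathcal N,\mathcal P\}$ denotes the misère-play outcome class of $G$ ($\mathcal L$: Left wins whoever starts; $\mathcal R$: Right wins whoever starts; $\mathcal N$: the player who moves first wins; $\mathcal P$: the player who moves second wins). $\overline G=\{\overline{\mathcal G^R}\mid\overline{\mathcal G^L}\}$ is the negative of $G$. Numbers are dyadic rationals, identified with their usual (normal-play canonical) game forms: $0=\{\cdot\mid\cdot\}$; $n=\{n-1\mid\cdot\}$ and $-n=\{\cdot\mid -(n-1)\}$ for positive integers $n$; and $\frac{2p+1}{2^q}=\left\{\frac{p}{2^{q-1}}\,\middle|\,\frac{p+1}{2^{q-1}}\right\}$ for integers $p$ and $q\ge 1$; so $\overline x$ is the form of the number $-x$. The ordinal sum is $G\!:\!H=\{\mathcal G^L,\,G\!:\!\mathcal H^L\mid \mathcal G^R,\,G\!:\!\mathcal H^R\}$; it binds more tightly than $+$. A dicot is a game such that in each of its positions (the game itself and all followers) either both players have an option or neither does; $\mathcal D$ is the class of all dicots. $G\equiv H\pmod{\mathcal D}$ means $o^-(G+X)=o^-(H+X)$ for all $X\in\mathcal D$. *)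

theory Defs
  imports Complex_Main "HOL-Library.FSet"
begin

section \<open>Finite partizan game forms\<close>

datatype game = Game (left_opts: "game fset") (right_opts: "game fset")

datatype player = Left | Right

fun opponent :: "player \<Rightarrow> player" where
  "opponent Left = Right"
| "opponent Right = Left"

fun options :: "player \<Rightarrow> game \<Rightarrow> game fset" where
  "options Left G = left_opts G"
| "options Right G = right_opts G"

definition is_option :: "game \<Rightarrow> game \<Rightarrow> bool" where
  "is_option H G \<longleftrightarrow> H |\<in>| left_opts G \<or> H |\<in>| right_opts G"

lemma size_fset_member: "x |\<in>| A \<Longrightarrow> f x < size_fset f A"
  unfolding size_fset.rep_eq
  using member_le_sum[of x "fset A" "Suc \<circ> f"] by (auto simp: less_eq_Suc_le)

lemma size_left_opts [termination_simp]: "H |\<in>| left_opts G \<Longrightarrow> size H < size G"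
  by (cases G) (auto dest: size_fset_member[where f = size])

lemma size_right_opts [termination_simp]: "H |\<in>| right_opts G \<Longrightarrow> size H < size G"
  by (cases G) (auto dest: size_fset_member[where f = size])

lemma size_opts [termination_simp]: "H |\<in>| options p G \<Longrightarrow> size H < size G"
  by (cases p) (auto simp: size_left_opts size_right_opts)

definition star :: game where
  "star = Game {|Game {||} {||}|} {|Game {||} {||}|}"

instantiation game :: "{zero, plus}"
begin

definition zero_game :: game where
  "0 = Game {||} {||}"

fun plus_game :: "game \<Rightarrow> game \<Rightarrow> game" where
  "plus_game G H = Game
     ((\<lambda>G'. plus_game G' H) |`| left_opts G |\<union>| (\<lambda>H'. plus_game G H') |`| left_opts H)
     ((\<lambda>G'. plus_game G' H) |`| right_opts G |\<union>| (\<lambda>H'. plus_game G H') |`| right_opts H)"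

instance ..

end

declare plus_game.simps [simp del]

primrec negative :: "game \<Rightarrow> game" where
  "negative (Game L R) = Game (negative |`| R) (negative |`| L)"

primrec ordinal_sum :: "game \<Rightarrow> game \<Rightarrow> game"  (infixr "\<triangleright>" 70) where
  "G \<triangleright> Game L R = Game (left_opts G |\<union>| (\<lambda>H. G \<triangleright> H) |`| L)
                        (right_opts G |\<union>| (\<lambda>H. G \<triangleright> H) |`| R)"


section \<open>Number forms\<close>

text \<open>\<open>number_form x G\<close> says that \<open>G\<close> is the form identified with the number \<open>x\<close>.
  The lemmas below show that exactly the dyadic rationals have a form, that it is unique, and that
  the form of \<open>- x\<close> is the negative of the form of \<open>x\<close>.\<close>

inductive number_form :: "rat \<Rightarrow> game \<Rightarrow> bool" where
  zero: "number_form 0 (Game {||} {||})"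
| pos_int: "n \<ge> 1 \<Longrightarrow> number_form (of_nat (n - 1)) G \<Longrightarrow>
    number_form (of_nat n) (Game {|G|} {||})"
| neg_int: "n \<ge> 1 \<Longrightarrow> number_form (- of_nat (n - 1)) G \<Longrightarrow>
    number_form (- of_nat n) (Game {||} {|G|})"
| fraction: "q \<ge> 1 \<Longrightarrow>
    number_form (of_int p / 2 ^ (q - 1)) G \<Longrightarrow>
    number_form (of_int (p + 1) / 2 ^ (q - 1)) H \<Longrightarrow>
    number_form (of_int (2 * p + 1) / 2 ^ q) (Game {|G|} {|H|})"

lemma odd_fraction_inj:
  fixes p p' :: int
  assumes "(of_int (2 * p + 1) :: rat) / 2 ^ q = of_int (2 * p' + 1) / 2 ^ q'"
  shows "q = q' \<and> p = p'"
proof -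
  have "(of_int (2 * p + 1) :: rat) * 2 ^ q' = of_int (2 * p' + 1) * 2 ^ q"
    using assms by (simp add: field_simps)
  then have "(of_int ((2 * p + 1) * 2 ^ q') :: rat) = of_int ((2 * p' + 1) * 2 ^ q)"
    by simp
  then have eq: "(2 * p + 1) * 2 ^ q' = (2 * p' + 1) * 2 ^ q"
    unfolding of_int_eq_iff .
  have aux: "\<not> a < b" if "(2 * r + 1) * 2 ^ b = (2 * s + 1) * 2 ^ a" for r s :: int and a b :: nat
  proof
    assume "a < b"
    then obtain d where "b = a + Suc d" using less_iff_Suc_add by auto
    with that have "(2 * r + 1) * 2 ^ Suc d = 2 * s + 1"
      by (simp add: power_add)
    then have "even (2 * s + 1)" by (metis dvd_mult dvd_power zero_less_Suc)
    then show False by simp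
  qed
  have "q = q'" using aux[OF eq] aux[OF eq[symmetric]] by simp
  with eq show ?thesis by simp
qed

lemma odd_fraction_not_int:
  fixes p m :: int
  assumes "q \<ge> 1"
  shows "(of_int (2 * p + 1) :: rat) / 2 ^ q \<noteq> of_int m"
proof
  assume "(of_int (2 * p + 1) :: rat) / 2 ^ q = of_int m"
  then have "(of_int (2 * p + 1) :: rat) = of_int (m * 2 ^ q)"
    by (simp add: field_simps)
  then have "2 * p + 1 = m * 2 ^ q" unfolding of_int_eq_iff .
  moreover have "even (m * 2 ^ q)" using assms by simp
  ultimately have "even (2 * p + 1)" by metis
  then show False by simp
qed

lemma number_form_unique: "number_form x G \<Longrightarrow> number_form x H \<Longrightarrow> G = H"
proof (induction arbitrary: H rule: number_form.induct)
  case zero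
  then show ?case
  proof cases
    case (fraction q p K L)
    have False using odd_fraction_not_int[OF fraction(3), of p 0] fraction(1) unfolding of_int_0 by metis
    then show ?thesis ..
  qed auto
next
  case (pos_int n G)
  have pos: "(of_nat n :: rat) > 0" using \<open>n \<ge> 1\<close> by simp
  from pos_int.prems show ?case
  proof cases
    case zero
    then show ?thesis using pos by simp
  next
    case (pos_int m K)
    then have "n = m" by (simp only: of_nat_eq_iff)
    with pos_int \<open>\<And>H. number_form (of_nat (n - 1)) H \<Longrightarrow> G = H\<close> show ?thesis by blast
  next
    case (neg_int m K)
    have "(of_nat m :: rat) \<ge> 0" by (rule of_nat_0_le_iff)
    with neg_int(1) pos show ?thesis by linarith
  next
    case (fraction q p K L)
    have False using odd_fraction_not_int[OF fraction(3), of p "int n"] fraction(1)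
      unfolding of_int_of_nat_eq by metis
    then show ?thesis ..
  qed
next
  case (neg_int n G)
  have pos: "(of_nat n :: rat) > 0" using \<open>n \<ge> 1\<close> by simp
  from neg_int.prems show ?case
  proof cases
    case zero
    then show ?thesis using pos by simp
  next
    case (pos_int m K)
    have "(of_nat m :: rat) \<ge> 0" by (rule of_nat_0_le_iff)
    with pos_int(1) pos show ?thesis by linarith
  next
    case (neg_int m K)
    then have "n = m" by (simp only: neg_equal_iff_equal of_nat_eq_iff)
    with neg_int \<open>\<And>H. number_form (- of_nat (n - 1)) H \<Longrightarrow> G = H\<close> show ?thesis by blast
  next
    case (fraction q p K L)
    have False using odd_fraction_not_int[OF fraction(3), of p "- int n"] fraction(1)
      unfolding of_int_of_nat_eq of_int_minus by metis
    then show ?thesis ..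
  qed
next
  case (fraction q p G H K)
  note not_int = odd_fraction_not_int[OF \<open>q \<ge> 1\<close>, of p]
  note IH = fraction.IH
  from fraction.prems show ?case
  proof cases
    case zero
    have False using not_int[of 0] zero(1) unfolding of_int_0 by metis
    then show ?thesis ..
  next
    case (pos_int m L)
    have False using not_int[of "int m"] pos_int(1) unfolding of_int_of_nat_eq by metis
    then show ?thesis ..
  next
    case (neg_int m L)
    have False using not_int[of "- int m"] neg_int(1) unfolding of_int_of_nat_eq of_int_minus by metis
    then show ?thesis ..
  next
    case (fraction q' p' L M)
    have "q = q' \<and> p = p'" by (rule odd_fraction_inj[OF fraction(1)])
    with fraction IH show ?thesis by blast
  qed
qed

lemma number_form_nat: "\<exists>G. number_form (of_nat n) G"
proof (induction n)
  case (Suc n)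
  then show ?case using number_form.pos_int[of "Suc n"] by auto
qed (use number_form.zero in auto)

lemma number_form_neg_nat: "\<exists>G. number_form (- of_nat n) G"
proof (induction n)
  case (Suc n)
  then show ?case using number_form.neg_int[of "Suc n"] by (metis diff_Suc_1 le_add1 plus_1_eq_Suc)
qed (use number_form.zero in auto)

lemma number_form_exists_dyadic: "\<exists>G. number_form (of_int m / 2 ^ q) G"
proof (induction q arbitrary: m)
  case 0
  show ?case
    by (cases m rule: int_cases2) (use number_form_nat number_form_neg_nat in auto)
next
  case (Suc q)
  show ?case
  proof (cases "even m")
    case True
    then obtain k where "m = 2 * k" by blast
    then have "(of_int m :: rat) / 2 ^ Suc q = of_int k / 2 ^ q" by simp
    with Suc[of k] show ?thesis by metis
  next
    case False
    then obtain k where k: "m = 2 * k + 1" by (rule oddE)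
    obtain G H where "number_form (of_int k / 2 ^ q) G" "number_form (of_int (k + 1) / 2 ^ q) H"
      using Suc by blast
    then have "number_form (of_int (2 * k + 1) / 2 ^ Suc q) (Game {|G|} {|H|})"
      by (intro number_form.fraction) simp_all
    then show ?thesis unfolding k ..
  qed
qed

lemma number_form_dyadic: "number_form x G \<Longrightarrow> \<exists>m q. x = of_int m / 2 ^ q"
proof (induction rule: number_form.induct)
  case zero
  show ?case by (intro exI[of _ 0]) simp
next
  case (pos_int n G)
  show ?case by (intro exI[of _ "int n"] exI[of _ 0]) simp
next
  case (neg_int n G)
  show ?case by (intro exI[of _ "- int n"] exI[of _ 0]) simp
qed blast

lemma number_form_negative: "number_form x G \<Longrightarrow> number_form (- x) (negative G)"
proof (induction rule: number_form.induct)
  case zero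
  then show ?case by (simp add: number_form.zero)
next
  case (pos_int n G)
  then show ?case by (simp add: number_form.neg_int)
next
  case (neg_int n G)
  then show ?case using number_form.pos_int[of n] by simp
next
  case (fraction q p G H)
  have eqs: "(of_int (- p - 1) / 2 ^ (q - 1) :: rat) = - (of_int (p + 1) / 2 ^ (q - 1))"
    "(of_int (- p - 1 + 1) / 2 ^ (q - 1) :: rat) = - (of_int p / 2 ^ (q - 1))"
    "(of_int (2 * (- p - 1) + 1) / 2 ^ q :: rat) = - (of_int (2 * p + 1) / 2 ^ q)"
    by (simp_all add: field_simps)
  show ?case
    using number_form.fraction[OF \<open>q \<ge> 1\<close>, of "- p - 1" "negative H" "negative G"]
      fraction.IH unfolding eqs by simp
qed


section \<open>Misere outcomes\<close>

text \<open>\<open>mover_wins p G\<close>: player \<open>p\<close>, moving first, wins \<open>G\<close> under misere play. Play is finite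
  and has no draws, so the player moving second wins exactly if \<open>\<not> mover_wins p G\<close>.\<close>

fun mover_wins :: "player \<Rightarrow> game \<Rightarrow> bool" where
  "mover_wins p G \<longleftrightarrow> options p G = {||} \<or>
     fBex (options p G) (\<lambda>G'. \<not> mover_wins (opponent p) G')"

declare mover_wins.simps [simp del]

datatype outcome_class = Left_win | Right_win | Next_win | Previous_win

definition outcome :: "game \<Rightarrow> outcome_class" where
  "outcome G =
    (if mover_wins Left G
     then if mover_wins Right G then Next_win else Left_win
     else if mover_wins Right G then Right_win else Previous_win)"


section \<open>Dicots and equivalence modulo a class\<close>

definition dicots :: "game set" where
  "dicots = {G. \<forall>H. is_option\<^sup>*\<^sup>* H G \<longrightarrow> (left_opts H = {||} \<longleftrightarrow> right_opts H = {||})}"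

definition equiv_modulo :: "game \<Rightarrow> game \<Rightarrow> game set \<Rightarrow> bool" where
  "equiv_modulo G H U \<longleftrightarrow> (\<forall>X\<in>U. outcome (G + X) = outcome (H + X))"

end

theory Submission
  imports Defs
begin

text \<open>
  Write \<open>A\<close> for \<open>\<ast>:G + \<ast>:(-G)\<close>. To show that adding \<open>A\<close> to a
  dicot \<open>X\<close> does not change who wins, the player who wins \<open>X\<close> keeps to the winning strategy on
  \<open>X\<close> and mirrors inside \<open>A\<close>: a move \<open>\<ast>:G \<rightarrow> \<ast>:G'\<close> is answered by
  \<open>\<ast>:(-G) \<rightarrow> \<ast>:(-G')\<close>, and a move of one summand to \<open>0\<close> by moving the other one to \<open>0\<close>.

  Under misere play this breaks down in one situation only: the strategy on \<open>X\<close> may rely on having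
  no move in \<open>X\<close>, while \<open>A\<close> still offers moves. As \<open>X\<close> is a dicot, \<open>X = 0\<close> then, and the player
  to move must win \<open>A\<close> itself. The way to do so is to reduce one of the two summands to \<open>0\<close>.
  What remains is a single game \<open>\<ast>:H\<close> with \<open>H = G\<close> or \<open>H = -G\<close>. There the move to \<open>0\<close> is always
  available and always loses, so it is a last resort which plays the part of being stuck in normal
  play: misere play of \<open>\<ast>:H\<close> is normal play of \<open>H\<close> (\<open>mover_wins_star_ordinal_sum\<close>). Hence a
  winning choice exists as soon as \<open>G\<close> is not a first-player win in normal play, because the mover
  can then pick the sign for which the opponent, moving next, loses.

  Mirroring replaces \<open>G\<close> by its followers, so the argument works for every \<open>G\<close> none of whose
  followers is a normal-play first-player win (\<open>mover_wins_star_ordinal_sum_cancel\<close>). Numbers have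
  this property: their followers are numbers, and in normal play a number \<open>x\<close> is won by Left if
  \<open>x > 0\<close>, by Right if \<open>x < 0\<close>, and by the second player if \<open>x = 0\<close> (\<open>normal_play_number_form\<close>).
\<close>

section \<open>Options of sums, negatives and ordinal sums\<close>

lemma opponent_opponent [simp]: "opponent (opponent p) = p"
  by (cases p) simp_all

lemma opts_zero [simp]: "left_opts 0 = {||}" "right_opts 0 = {||}"
  by (simp_all add: zero_game_def)

lemma options_zero [simp]: "options p 0 = {||}"
  by (cases p) simp_all

lemma options_plus:
  "options p (G + H) = (\<lambda>G'. G' + H) |`| options p G |\<union>| (\<lambda>H'. G + H') |`| options p H"
  by (cases p) (simp_all add: plus_game.simps[of G H])

lemma options_negative: "options p (negative G) = negative |`| options (opponent p) G"
  by (cases G; cases p) simp_all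

lemma options_star_ordinal_sum:
  "options p (star \<triangleright> G) = finsert 0 ((\<triangleright>) star |`| options p G)"
  by (cases G; cases p) (simp_all add: star_def zero_game_def)

lemma is_option_iff: "is_option H G \<longleftrightarrow> (\<exists>p. H |\<in>| options p G)"
  unfolding is_option_def by (metis options.simps player.exhaust)

lemma zero_plus_game [simp]: "0 + (G :: game) = G"
proof (induction G)
  case (Game L R)
  then show ?case
    by (simp add: plus_game.simps[of 0 "Game L R"] fset.map_ident_strong)
qed

lemma plus_zero_game [simp]: "(G :: game) + 0 = G"
proof (induction G)
  case (Game L R)
  then show ?case
    by (simp add: plus_game.simps[of "Game L R" 0] fset.map_ident_strong)
qed


section \<open>Misere play of an ordinal sum with star is normal play\<close>

text \<open>Under normal play, a player who cannot move loses.\<close>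

fun normal_mover_wins :: "player \<Rightarrow> game \<Rightarrow> bool" where
  "normal_mover_wins p G \<longleftrightarrow>
     fBex (options p G) (\<lambda>G'. \<not> normal_mover_wins (opponent p) G')"

declare normal_mover_wins.simps [simp del]

lemma normal_mover_wins_Game [simp]:
  "normal_mover_wins Left (Game L R) \<longleftrightarrow> fBex L (\<lambda>G'. \<not> normal_mover_wins Right G')"
  "normal_mover_wins Right (Game L R) \<longleftrightarrow> fBex R (\<lambda>G'. \<not> normal_mover_wins Left G')"
  by (subst normal_mover_wins.simps, simp)+

lemma normal_mover_wins_negative:
  "normal_mover_wins p (negative G) \<longleftrightarrow> normal_mover_wins (opponent p) G"
proof (induction G arbitrary: p rule: measure_induct_rule[of size])
  case (less G)
  have "normal_mover_wins p (negative G) \<longleftrightarrow>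
      fBex (options (opponent p) G) (\<lambda>G'. \<not> normal_mover_wins (opponent p) (negative G'))"
    by (subst normal_mover_wins.simps) (auto simp: options_negative)
  also have "\<dots> \<longleftrightarrow>
      fBex (options (opponent p) G) (\<lambda>G'. \<not> normal_mover_wins (opponent (opponent p)) G')"
    by (rule fBex_cong) (simp_all add: less size_opts)
  also have "\<dots> \<longleftrightarrow> normal_mover_wins (opponent p) G"
    by (rule normal_mover_wins.simps[symmetric])
  finally show ?case .
qed

text \<open>Moving to \<open>0\<close> is possible in every \<open>\<ast>:G\<close>, and it loses at once, since it leaves the opponent
  without a move. So a player who is stuck in \<open>G\<close> loses, exactly as in normal play.\<close>

lemma mover_wins_star_ordinal_sum: "mover_wins p (star \<triangleright> G) \<longleftrightarrow> normal_mover_wins p G"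
proof (induction G arbitrary: p rule: measure_induct_rule[of size])
  case (less G)
  have "mover_wins q 0" for q
    by (subst mover_wins.simps) simp
  then have "mover_wins p (star \<triangleright> G) \<longleftrightarrow>
      fBex (options p G) (\<lambda>G'. \<not> mover_wins (opponent p) (star \<triangleright> G'))"
    by (subst mover_wins.simps) (auto simp: options_star_ordinal_sum)
  also have "\<dots> \<longleftrightarrow> fBex (options p G) (\<lambda>G'. \<not> normal_mover_wins (opponent p) G')"
    by (rule fBex_cong) (simp_all add: less size_opts)
  also have "\<dots> \<longleftrightarrow> normal_mover_wins p G"
    by (rule normal_mover_wins.simps[symmetric])
  finally show ?case .
qed


section \<open>Cancellation modulo dicots\<close>

lemma mover_winsI:
  "H |\<in>| options p G \<Longrightarrow> \<not> mover_wins (opponent p) H \<Longrightarrow> mover_wins p G"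
  by (subst mover_wins.simps) blast

lemma mover_winsE:
  assumes "mover_wins p G" "options p G \<noteq> {||}"
  obtains H where "H |\<in>| options p G" "\<not> mover_wins (opponent p) H"
  using assms mover_wins.simps[of p G] by blast

lemma dicot_option:
  assumes "X \<in> dicots" "X' |\<in>| options p X"
  shows "X' \<in> dicots"
proof -
  have "is_option X' X"
    using assms(2) is_option_iff by blast
  then show ?thesis
    using assms(1) unfolding dicots_def by (blast intro: rtranclp.rtrancl_into_rtrancl)
qed

lemma dicot_immobile_eq_zero:
  assumes "X \<in> dicots" "options p X = {||}"
  shows "X = 0"
proof -
  have "left_opts X = {||} \<longleftrightarrow> right_opts X = {||}"
    using assms(1) unfolding dicots_def by blast
  with assms(2) show ?thesis
    by (cases X; cases p) (simp_all add: zero_game_def)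
qed

text \<open>The case in which mirroring is unavailable. The mover takes one summand to \<open>0\<close> and needs the
  opponent to lose normal play, moving first, on what is left: \<open>G\<close> or \<open>negative G\<close>. As negation
  exchanges the roles of the players, both choices fail only if both players win \<open>G\<close> by moving
  first.\<close>

lemma mover_wins_star_ordinal_sum_negative:
  assumes "\<not> (normal_mover_wins Left G \<and> normal_mover_wins Right G)"
  shows "mover_wins p (star \<triangleright> G + star \<triangleright> negative G)"
proof -
  consider "\<not> normal_mover_wins (opponent p) G" | "\<not> normal_mover_wins p G"
    using assms by (cases p) auto
  then show ?thesis
  proof cases
    case 1
    have "star \<triangleright> G |\<in>| options p (star \<triangleright> G + star \<triangleright> negative G)"
      by (simp add: options_plus options_star_ordinal_sum)
    then show ?thesis
      by (rule mover_winsI) (simp add: mover_wins_star_ordinal_sum 1)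
  next
    case 2
    have "star \<triangleright> negative G |\<in>| options p (star \<triangleright> G + star \<triangleright> negative G)"
      by (simp add: options_plus options_star_ordinal_sum)
    then show ?thesis
      by (rule mover_winsI) (simp add: mover_wins_star_ordinal_sum normal_mover_wins_negative 2)
  qed
qed

text \<open>If a first move in one of the two ordinal sums wins, then so
  does the mover's next turn after the opponent's mirroring reply. That reply restores a sum of the
  same shape over a smaller \<open>G\<close>, or leaves just \<open>X\<close>, so the mover wins \<open>X\<close> too. Moves in \<open>X\<close>
  carry over by induction in both directions. The induction is on the joint size, since either part
  may shrink.\<close>

lemma mover_wins_star_ordinal_sum_cancel:
  assumes "\<And>H. is_option\<^sup>*\<^sup>* H G \<Longrightarrow> \<not> (normal_mover_wins Left H \<and> normal_mover_wins Right H)"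
    and "X \<in> dicots"
  shows "mover_wins p (star \<triangleright> G + star \<triangleright> negative G + X) \<longleftrightarrow> mover_wins p X"
  using assms
proof (induction "size G + size X" arbitrary: G X p rule: less_induct)
  case less
  let ?A = "\<lambda>G. star \<triangleright> G + star \<triangleright> negative G"
  have IH_X: "mover_wins q (?A G + X') \<longleftrightarrow> mover_wins q X'" if "X' |\<in>| options p X" for q X'
    using less.hyps[of G X' q] less.prems dicot_option[of X X' p] size_opts[OF that] that by simp
  have IH_G: "mover_wins q (?A G' + X) \<longleftrightarrow> mover_wins q X" if "G' |\<in>| options r G" for q r G'
  proof -
    have "\<not> (normal_mover_wins Left H \<and> normal_mover_wins Right H)" if "is_option\<^sup>*\<^sup>* H G'" for H
      using less.prems(1)[of H] that \<open>G' |\<in>| options r G\<close>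
      by (meson is_option_iff rtranclp.rtrancl_into_rtrancl)
    then show ?thesis
      using less.hyps[of G' X q] less.prems(2) size_opts[OF that] by simp
  qed
  show ?case
  proof
    assume "mover_wins p (?A G + X)"
    moreover have "options p (?A G + X) \<noteq> {||}"
      by (simp add: options_plus options_star_ordinal_sum)
    ultimately obtain Y where Y: "Y |\<in>| options p (?A G + X)" "\<not> mover_wins (opponent p) Y"
      by (rule mover_winsE)
    have reply: "mover_wins p Z" if "Z |\<in>| options (opponent p) Y" for Z
      using Y(2) mover_winsI[OF that] by auto
    from Y(1) consider
        (X) X' where "X' |\<in>| options p X" "Y = ?A G + X'"
      | (zero_left) "Y = 0 + star \<triangleright> negative G + X"
      | (zero_right) "Y = star \<triangleright> G + 0 + X"
      | (left) G' where "G' |\<in>| options p G" "Y = star \<triangleright> G' + star \<triangleright> negative G + X"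
      | (right) G' where "G' |\<in>| options (opponent p) G" "Y = star \<triangleright> G + star \<triangleright> negative G' + X"
      by (auto simp: options_plus options_star_ordinal_sum options_negative)
    then show "mover_wins p X"
    proof cases
      case X
      with Y(2) show ?thesis by (auto simp: IH_X intro: mover_winsI)
    next
      case zero_left
      have "0 + 0 + X |\<in>| options (opponent p) Y"
        unfolding zero_left by (simp add: options_plus options_star_ordinal_sum)
      from reply[OF this] show ?thesis by simp
    next
      case zero_right
      have "0 + 0 + X |\<in>| options (opponent p) Y"
        unfolding zero_right by (simp add: options_plus options_star_ordinal_sum)
      from reply[OF this] show ?thesis by simp
    next
      case left
      then have "?A G' + X |\<in>| options (opponent p) Y"
        by (auto simp: options_plus options_star_ordinal_sum options_negative)
      from reply[OF this] show ?thesis using IH_G left(1) by simp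
    next
      case right
      then have "?A G' + X |\<in>| options (opponent p) Y"
        by (auto simp: options_plus options_star_ordinal_sum options_negative)
      from reply[OF this] show ?thesis using IH_G right(1) by simp
    qed
  next
    assume wins: "mover_wins p X"
    show "mover_wins p (?A G + X)"
    proof (cases "options p X = {||}")
      case True
      then have "X = 0" by (rule dicot_immobile_eq_zero[OF less.prems(2)])
      then show ?thesis
        using mover_wins_star_ordinal_sum_negative less.prems(1) by simp
    next
      case False
      with wins obtain X' where X': "X' |\<in>| options p X" "\<not> mover_wins (opponent p) X'"
        by (rule mover_winsE)
      then have "?A G + X' |\<in>| options p (?A G + X)" "\<not> mover_wins (opponent p) (?A G + X')"
        by (simp_all add: options_plus IH_X)
      then show ?thesis by (rule mover_winsI)
    qed
  qed
qed

lemma star_ordinal_sum_cancel: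
  assumes "\<And>H. is_option\<^sup>*\<^sup>* H G \<Longrightarrow> \<not> (normal_mover_wins Left H \<and> normal_mover_wins Right H)"
  shows "equiv_modulo (star \<triangleright> G + star \<triangleright> negative G) 0 dicots"
  unfolding equiv_modulo_def outcome_def
  by (simp add: mover_wins_star_ordinal_sum_cancel[OF assms])


section \<open>Normal play of numbers\<close>

text \<open>The four claims need each other: a Right option of \<open>x \<ge> 0\<close> is a number \<open>> 0\<close>, where Left
  wins by moving first because some Left option of a number \<open>> 0\<close> is still \<open>\<ge> 0\<close>; and dually. For
  fractions the last point is integrality: \<open>2 * p + 1 > 0\<close> forces \<open>p \<ge> 0\<close>.\<close>

lemma normal_play_number_form:
  assumes "number_form x G"
  shows "(x \<ge> 0 \<longrightarrow> \<not> normal_mover_wins Right G) \<and> (x > 0 \<longrightarrow> normal_mover_wins Left G) \<and>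
    (x \<le> 0 \<longrightarrow> \<not> normal_mover_wins Left G) \<and> (x < 0 \<longrightarrow> normal_mover_wins Right G)"
  using assms
proof (induction rule: number_form.induct)
  case zero
  show ?case by simp
next
  case (pos_int n G)
  then show ?case by simp
next
  case (neg_int n G)
  then show ?case by simp
next
  case (fraction q p G H)
  have sign: "(of_int m :: rat) / 2 ^ k \<ge> 0 \<longleftrightarrow> m \<ge> 0" "(of_int m :: rat) / 2 ^ k > 0 \<longleftrightarrow> m > 0"
    "(of_int m :: rat) / 2 ^ k \<le> 0 \<longleftrightarrow> m \<le> 0" "(of_int m :: rat) / 2 ^ k < 0 \<longleftrightarrow> m < 0"
    for m :: int and k
    by (simp_all add: zero_le_divide_iff zero_less_divide_iff divide_le_0_iff divide_less_0_iff
        flip: not_less)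
  have Left: "normal_mover_wins Left (Game {|G|} {|H|}) \<longleftrightarrow> \<not> normal_mover_wins Right G"
    and Right: "normal_mover_wins Right (Game {|G|} {|H|}) \<longleftrightarrow> \<not> normal_mover_wins Left H"
    by simp_all
  from fraction.IH show ?case
    unfolding sign Left Right by (cases "p \<ge> 0") auto
qed

lemma number_form_option:
  assumes "number_form x G" "is_option H G"
  shows "\<exists>y. number_form y H"
  using assms(1) by cases (use assms(2) in \<open>auto simp: is_option_def\<close>)

lemma number_form_follower:
  assumes "is_option\<^sup>*\<^sup>* H G" "number_form x G"
  shows "\<exists>y. number_form y H"
  using assms(1)
  by (induction rule: converse_rtranclp_induct) (use assms(2) number_form_option in blast)+

theorem corollary2p5:
  fixes x :: rat and G :: game
  assumes "number_form x G"
  shows "equiv_modulo (star \<triangleright> G + star \<triangleright> negative G) 0 dicots"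
proof (rule star_ordinal_sum_cancel)
  fix H
  assume "is_option\<^sup>*\<^sup>* H G"
  then obtain y where "number_form y H"
    using number_form_follower assms by blast
  then show "\<not> (normal_mover_wins Left H \<and> normal_mover_wins Right H)"
    using normal_play_number_form[of y H] linear[of y 0] by blast
qed

end
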